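(* Let $V$ be a finite set of cardinality $v$ and let $D_1,D_2$ be block designs built on $V$ with parameters $(v,b_i,r_i,k_i,\lambda_i)$, $i=1,2$, with blocks listed as $B_1^1,\dots,B_1^{b_1}$ and $B_2^1,\dots,B_2^{b_2}$. Let $M$ be the $b_1\times b_2$ matrix with entries $M_{ij}=|B_1^i\cap B_2^j|$. Then the matrix $MM^T\in\mathrm{Mat}(b_1,\mathbb R)$ has rank $v$ and has (1) the eigenvalue $\mu_1=r_1r_2k_1k_2$ with eigenspace spanned by $(1,\dots,1)^T$; (2) the eigenvalue $\mu_2=(r_1-\lambda_1)(r_2-\lambda_2)$ with eigenspace equal to $V_{D_1}$, which has dimension $v-1$. In particular, since $b_1\ge v$, the characteristic polynomial of $MM^T$ is $$\det(MM^T-tI)=(-1)^{b_1}t^{b_1-v}(t-\mu_1)(t-\mu_2)^{v-1}.$$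
   Context: A (balanced incomplete) block design with parameters $(v,b,r,k,\lambda)$ built on a finite set $V$ with $|V|=v$ is a list (repetitions allowed) of $b$ blocks, each a $k$-element subset of $V$ with $k<v$, such that every element of $V$ lies in exactly $r$ blocks and every pair of distinct elements of $V$ lies in exactly $\lambda$ blocks; here $b,r,k,\lambda$ are positive integers, except that the paper also regards the design whose blocks are the $v$ one-element subsets of $V$ (parameters $b=v$, $r=k=1$, $\lambda=0$) as a block design. For $x,y\in V$, $\mathcal Z_{D_1}(x,y)\in\mathbb R^{b_1}$ is the vector whose $j$-th component is $0$ if both $x,y\in B_1^j$ or both $x,y\notin B_1^j$; $1$ if $x\in B_1^j$ and $y\notin B_1^j$; $-1$ if $x\notin B_1^j$ and $y\in B_1^j$; and $V_{D_1}=\mathrm{Span}\{\mathcal Z_{D_1}(x,y): x,y\in V\}$.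
   Formalization: The two eigenspace equalities are claimed only when D_1 and D_2 are not both the design of one-element subsets (there MM^T = I, μ_1 = μ_2 = 1, and they fail; only the inclusions are claimed); k<v is required of that design too, so v≥2. *)

theory Defs
  imports "HOL-Analysis.Analysis" "HOL-Computational_Algebra.Polynomial"
begin

text \<open>A list of \<open>b\<close> blocks, repetitions allowed, is a family \<open>B\<close> indexed by a finite type
  \<open>'b\<close> with \<open>CARD('b) = b\<close>.\<close>

definition singleton_design :: "'a set \<Rightarrow> ('b::finite \<Rightarrow> 'a set) \<Rightarrow> bool" where
  "singleton_design V B \<longleftrightarrow> bij_betw B UNIV ((\<lambda>x. {x}) ` V)"

text \<open>The last conjunct is the positivity requirement on the parameters, which is waived only
  for the design consisting of the one-element subsets of \<open>V\<close>.\<close>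

definition block_design ::
  "'a set \<Rightarrow> ('b::finite \<Rightarrow> 'a set) \<Rightarrow> nat \<Rightarrow> nat \<Rightarrow> nat \<Rightarrow> nat \<Rightarrow> nat \<Rightarrow> bool" where
  "block_design V B v b r k l \<longleftrightarrow>
     finite V \<and> card V = v \<and> CARD('b) = b \<and> k < v \<and>
     (\<forall>j. B j \<subseteq> V \<and> card (B j) = k) \<and>
     (\<forall>x\<in>V. card {j. x \<in> B j} = r) \<and>
     (\<forall>x\<in>V. \<forall>y\<in>V. x \<noteq> y \<longrightarrow> card {j. x \<in> B j \<and> y \<in> B j} = l) \<and>
     ((b > 0 \<and> r > 0 \<and> k > 0 \<and> l > 0) \<or>
      (singleton_design V B \<and> b = v \<and> r = 1 \<and> k = 1 \<and> l = 0))"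

definition intersection_matrix ::
  "('b1::finite \<Rightarrow> 'a set) \<Rightarrow> ('b2::finite \<Rightarrow> 'a set) \<Rightarrow> real ^ 'b2 ^ 'b1" where
  "intersection_matrix B1 B2 = (\<chi> i j. real (card (B1 i \<inter> B2 j)))"

definition Z_vec :: "('b::finite \<Rightarrow> 'a set) \<Rightarrow> 'a \<Rightarrow> 'a \<Rightarrow> real ^ 'b" where
  "Z_vec B x y = (\<chi> j. if x \<in> B j \<and> y \<notin> B j then 1
                      else if x \<notin> B j \<and> y \<in> B j then -1 else 0)"

definition V_space :: "'a set \<Rightarrow> ('b::finite \<Rightarrow> 'a set) \<Rightarrow> (real ^ 'b) set" where
  "V_space V B = span {Z_vec B x y | x y. x \<in> V \<and> y \<in> V}"

definition eigenspace :: "real ^ 'n ^ 'n \<Rightarrow> real \<Rightarrow> (real ^ 'n) set" where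
  "eigenspace A \<mu> = {x. A *v x = \<mu> *\<^sub>R x}"

definition eigenvalue :: "real ^ 'n ^ 'n \<Rightarrow> real \<Rightarrow> bool" where
  "eigenvalue A \<mu> \<longleftrightarrow> (\<exists>x. x \<noteq> 0 \<and> A *v x = \<mu> *\<^sub>R x)"

text \<open>The polynomial \<open>det (A - t I)\<close> in the indeterminate \<open>t = [:0, 1:]\<close>; note the sign
  convention, which differs from \<open>det (t I - A)\<close>.\<close>

definition charpoly :: "real ^ 'n ^ 'n \<Rightarrow> real poly" where
  "charpoly A = det (map_matrix (\<lambda>a. [:a:]) A - mat [:0, 1:])"

end

theory Submission
  imports Defs
begin

text \<open>Write \<open>e x\<close> for the incidence vector of a point \<open>x\<close> with respect to the blocks of the first
  design. Double counting in the second design gives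
  \<open>M M\<^sup>T = (r2 - l2) \<Sum>x. e x (e x)\<^sup>T + l2 k1\<^sup>2 J\<close> with \<open>J\<close> the all-ones matrix, so the action of
  \<open>M M\<^sup>T\<close> can be read off from \<open>e x \<bullet> e y = l1 + (r1 - l1) \<delta>\<close>, \<open>e x \<bullet> 1 = r1\<close> and
  \<open>\<Sum>x. e x = k1 1\<close>: it is \<open>\<mu>1\<close> on \<open>1\<close>, \<open>\<mu>2\<close> on the differences \<open>e x - e y\<close>, and \<open>0\<close> on the
  orthogonal complement of the span of the \<open>e x\<close>. The vectors \<open>e x\<close> are independent, so these three
  mutually orthogonal spaces have dimensions \<open>1\<close>, \<open>v - 1\<close> and \<open>b1 - v\<close>, and an orthogonal eigenbasis
  yields the characteristic polynomial.\<close>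

section \<open>Characteristic polynomial of a matrix with an eigenbasis\<close>

lemma sum_const_poly: "(\<Sum>i\<in>I. [:g i:]) = [:\<Sum>i\<in>I. g i:]"
  by (induction I rule: infinite_finite_induct) auto

lemma prod_const_poly:
  fixes g :: "'i \<Rightarrow> 'c::comm_semiring_1"
  shows "(\<Prod>i\<in>I. [:g i:]) = [:\<Prod>i\<in>I. g i:]"
  by (induction I rule: infinite_finite_induct) (auto simp: one_pCons mult.commute)

text \<open>Rewrites factors mu - t as t - mu: the simple factor and the two powers contribute 1 + p
  + q signs, a number that will be the size of the matrix.\<close>

lemma neg_mult_power_neg:
  fixes a b c :: "'c::comm_ring_1"
  shows "(- a) * (- b) ^ p * (- c) ^ q = (-1) ^ Suc (p + q) * c ^ q * a * b ^ p"
  by (simp add: power_minus[of b] power_minus[of c] power_add mult_ac)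

text \<open>With the eigenvectors as columns of \<open>P\<close>, (A - tI) P = P D holds over the
  polynomial ring, where \<open>D\<close> is diagonal with entries d - t. Taking determinants and
  cancelling det P avoids inverting \<open>P\<close>.\<close>

lemma charpoly_eigenbasis:
  fixes A :: "real ^ 'n ^ 'n"
  assumes indep: "independent S" and card: "card S = CARD('n)"
    and eig: "\<And>s. s \<in> S \<Longrightarrow> A *v s = d s *\<^sub>R s"
  shows "charpoly A = (\<Prod>s\<in>S. [:d s, -1:])"
proof -
  have "finite S"
    using indep independent_imp_finite by blast
  then obtain f :: "'n \<Rightarrow> real ^ 'n" where f: "bij_betw f UNIV S"
    using card finite_same_card_bij[of "UNIV :: 'n set" S] by auto
  define P :: "real ^ 'n ^ 'n" where "P = (\<chi> i j. f j $ i)"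
  define D :: "real poly ^ 'n ^ 'n" where "D = (\<chi> i j. if i = j then [:d (f i), -1:] else 0)"
  have "columns P = S"
    using f by (auto simp: columns_def column_def P_def bij_betw_def)
  moreover have "span S = UNIV"
    using indep card by (metis card_eq_dim dim_UNIV DIM_cart DIM_real mult.right_neutral
        subset_UNIV top.extremum_uniqueI \<open>finite S\<close>)
  ultimately have "det P \<noteq> 0"
    using matrix_right_invertible_span_columns[of P] invertible_det_nz[of P]
      invertible_right_inverse[of P] by (simp add: span_vec_eq)
  \<comment> \<open>The determinant of a matrix of constant polynomials is the constant det P, hence
    nonzero and cancellable in the integral domain of polynomials.\<close>
  moreover have detP: "det (map_matrix (\<lambda>a. [:a:]) P) = [:det P:]"
  proof -
    have "of_int n = [:of_int n :: real:]" for n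
      by (simp add: of_int_poly)
    then show ?thesis
      by (simp add: det_def map_matrix_def prod_const_poly mult.commute
          flip: sum_const_poly)
  qed
  moreover have "(map_matrix (\<lambda>a. [:a:]) A - mat [:0, 1:]) ** map_matrix (\<lambda>a. [:a:]) P
      = map_matrix (\<lambda>a. [:a:]) P ** D"
  proof -
    have "(\<Sum>k\<in>UNIV. A $ i $ k * f j $ k) = d (f j) * f j $ i" for i j
      using arg_cong[OF eig[of "f j"], of "\<lambda>x. x $ i"] f
      by (auto simp: matrix_vector_mult_def bij_betw_def)
    then show ?thesis
      by (simp add: vec_eq_iff matrix_matrix_mult_def map_matrix_def mat_def D_def P_def
          smult_diff_right sum_subtractf if_distrib[of "smult _"] if_distrib[of "\<lambda>x. _ * x"]
          sum_const_poly mult.commute cong: if_cong)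
  qed
  then have "charpoly A * det (map_matrix (\<lambda>a. [:a:]) P) = det (map_matrix (\<lambda>a. [:a:]) P) * det D"
    unfolding charpoly_def by (metis det_mul)
  ultimately have "charpoly A = det D"
    by (metis mult.commute mult_cancel_left pCons_eq_0_iff)
  also have "\<dots> = (\<Prod>i\<in>UNIV. [:d (f i), -1:])"
    by (subst det_diagonal) (auto simp: D_def)
  also have "\<dots> = (\<Prod>s\<in>S. [:d s, -1:])"
    using f by (rule prod.reindex_bij_betw)
  finally show ?thesis .
qed

section \<open>Counting identities for the design parameters\<close>

lemma design_replication_identity:
  assumes "block_design V B v b r k l"
  shows "r * (k - 1) = l * (v - 1)" "b * k = v * r"
proof -
  note D = assms[unfolded block_design_def]
  have fin: "finite V" and B: "\<And>j. B j \<subseteq> V" "\<And>j. card (B j) = k" using D by auto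
  \<comment> \<open>Double counting of the incident pairs of a point and a block.\<close>
  have "b * k = (\<Sum>j\<in>UNIV. card (B j))" using D by auto
  also have "\<dots> = (\<Sum>j\<in>UNIV. \<Sum>x\<in>V. of_bool (x \<in> B j))"
    using B fin by (intro sum.cong refl) (simp add: Int_absorb1)
  also have "\<dots> = (\<Sum>x\<in>V. \<Sum>j\<in>UNIV. of_bool (x \<in> B j))" by (rule sum.swap)
  also have "\<dots> = v * r" using D by simp
  finally show "b * k = v * r" .
  \<comment> \<open>For a fixed point \<open>x\<close>, double counting of the pairs of another
    point \<open>y\<close> and a block through both.\<close>
  obtain x where x: "x \<in> V" using D by (metis card.empty equals0I less_nat_zero_code)
  have "r * (k - 1) = (\<Sum>j | x \<in> B j. card (B j - {x}))" using D x by simp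
  also have "\<dots> = (\<Sum>j | x \<in> B j. \<Sum>y\<in>V - {x}. of_bool (y \<in> B j))"
  proof (intro sum.cong refl)
    fix j
    have "(V - {x}) \<inter> B j = B j - {x}" using B(1)[of j] by auto
    then show "card (B j - {x}) = (\<Sum>y\<in>V - {x}. of_bool (y \<in> B j))"
      using fin by simp
  qed
  also have "\<dots> = (\<Sum>y\<in>V - {x}. \<Sum>j | x \<in> B j. of_bool (y \<in> B j))" by (rule sum.swap)
  also have "\<dots> = (\<Sum>y\<in>V - {x}. card {j. x \<in> B j \<and> y \<in> B j})" by (simp add: Collect_conj_eq)
  also have "\<dots> = (\<Sum>y\<in>V - {x}. l)" using D x by (intro sum.cong) auto
  also have "\<dots> = l * (v - 1)" using D x by simp
  finally show "r * (k - 1) = l * (v - 1)" .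
qed

text \<open>For l > 0, the identity r (k - 1) = l (v - 1) with k < v forces the inequality; l = 0
  occurs only for the singleton design, where r = 1. Strictness makes the Gram matrix of the
  incidence vectors nonsingular and \<open>\<mu>2\<close> nonzero.\<close>

lemma design_index_less_replication:
  assumes "block_design V B v b r k l"
  shows "l < r"
proof (cases "l = 0")
  case True
  then show ?thesis using assms by (auto simp: block_design_def)
next
  case False
  then have "0 < k" "k < v" "0 < r" using assms by (auto simp: block_design_def)
  then have "r * (k - 1) < r * (v - 1)" by simp
  then show ?thesis
    using design_replication_identity(1)[OF assms] by (metis mult_less_cancel2)
qed

section \<open>Incidence vectors of points and their Gram matrix\<close>

definition incidence_vec :: "('b::finite \<Rightarrow> 'a set) \<Rightarrow> 'a \<Rightarrow> real ^ 'b" where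
  "incidence_vec B x = (\<chi> j. of_bool (x \<in> B j))"

lemma Z_vec_eq: "Z_vec B x y = incidence_vec B x - incidence_vec B y"
  by (simp add: Z_vec_def incidence_vec_def vec_eq_iff)

text \<open>Coordinates are 0 or 1, so the inner product counts common blocks; the Gram matrix is (r
  - l) I + l J.\<close>

lemma incidence_vec_inner:
  assumes "block_design V B v b r k l" "x \<in> V" "y \<in> V"
  shows "incidence_vec B x \<bullet> incidence_vec B y = real l + (real r - real l) * of_bool (x = y)"
proof -
  have "incidence_vec B x \<bullet> incidence_vec B y = (\<Sum>j\<in>UNIV. of_bool (x \<in> B j \<and> y \<in> B j))"
    by (simp add: incidence_vec_def inner_vec_def flip: of_bool_conj)
  also have "\<dots> = card {j. x \<in> B j \<and> y \<in> B j}" by simp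
  finally show ?thesis using assms by (auto simp: block_design_def)
qed

lemma incidence_vec_inner_one:
  assumes "block_design V B v b r k l" "x \<in> V"
  shows "incidence_vec B x \<bullet> 1 = real r"
  using assms by (simp add: incidence_vec_def inner_vec_def block_design_def)

lemma sum_incidence_vec:
  assumes "block_design V B v b r k l"
  shows "(\<Sum>x\<in>V. incidence_vec B x) = real k *\<^sub>R 1"
proof -
  have "finite V" "V \<inter> B j = B j" for j using assms by (auto simp: block_design_def)
  then show ?thesis using assms
    by (simp add: incidence_vec_def vec_eq_iff block_design_def)
qed

text \<open>If E and G are the point-block incidence matrices of the two designs, then M = E^T G, so
  M M^T = E^T (G G^T) E with G G^T = (r2 - l2) I + l2 J. The J part collapses because the incidence
  vectors of the first design sum to k1 times the all-ones vector.\<close>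

lemma intersection_matrix_mult_transpose:
  fixes B1 :: "'b1::finite \<Rightarrow> 'a set" and B2 :: "'b2::finite \<Rightarrow> 'a set"
  assumes D1: "block_design V B1 v b1 r1 k1 l1" and D2: "block_design V B2 v b2 r2 k2 l2"
  shows "(intersection_matrix B1 B2 ** transpose (intersection_matrix B1 B2)) *v w =
    (real r2 - real l2) *\<^sub>R (\<Sum>x\<in>V. (incidence_vec B1 x \<bullet> w) *\<^sub>R incidence_vec B1 x)
      + (real l2 * (real k1)\<^sup>2 * (1 \<bullet> w)) *\<^sub>R 1"
proof -
  define e where "e = incidence_vec B1"
  define g where "g = incidence_vec B2"
  have fin: "finite V" and sub: "\<And>i. B1 i \<subseteq> V" using D1 by (auto simp: block_design_def)
  have col: "column j (intersection_matrix B1 B2) = (\<Sum>x\<in>V. g x $ j *\<^sub>R e x)" for j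
  proof -
    have "real (card (B1 i \<inter> B2 j)) = (\<Sum>x\<in>V. of_bool (x \<in> B2 j) * of_bool (x \<in> B1 i))" for i
    proof -
      have "B1 i \<inter> B2 j = V \<inter> {x. x \<in> B2 j \<and> x \<in> B1 i}" using sub by auto
      then show ?thesis using fin by (simp flip: of_bool_conj)
    qed
    then show ?thesis
      by (simp add: column_def intersection_matrix_def vec_eq_iff e_def g_def incidence_vec_def)
  qed
  have inn: "g x \<bullet> g y = real l2 + (real r2 - real l2) * of_bool (x = y)" if "x \<in> V" "y \<in> V" for x y
    using incidence_vec_inner[OF D2] that by (simp add: g_def)
  have se: "(\<Sum>x\<in>V. e x) = real k1 *\<^sub>R 1" unfolding e_def by (rule sum_incidence_vec[OF D1])
  \<comment> \<open>M M^T w is the sum of (c . w) c over the columns c of M.\<close>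
  have "(intersection_matrix B1 B2 ** transpose (intersection_matrix B1 B2)) *v w
      = (\<Sum>j\<in>UNIV. (column j (intersection_matrix B1 B2) \<bullet> w) *\<^sub>R column j (intersection_matrix B1 B2))"
    unfolding matrix_vector_mul_assoc[symmetric]
    by (simp add: vec_eq_iff matrix_vector_mult_def transpose_def column_def inner_vec_def mult.commute)
  also have "\<dots> = (\<Sum>j\<in>UNIV. \<Sum>x\<in>V. \<Sum>y\<in>V. (g x $ j * g y $ j * (e y \<bullet> w)) *\<^sub>R e x)"
    unfolding col inner_sum_left scaleR_sum_right
    by (simp add: scaleR_sum_left sum_distrib_left mult_ac)
  also have "\<dots> = (\<Sum>x\<in>V. \<Sum>y\<in>V. \<Sum>j\<in>UNIV. (g x $ j * g y $ j * (e y \<bullet> w)) *\<^sub>R e x)"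
    by (subst sum.swap, rule sum.cong[OF refl], rule sum.swap)
  also have "\<dots> = (\<Sum>x\<in>V. \<Sum>y\<in>V. ((g x \<bullet> g y) * (e y \<bullet> w)) *\<^sub>R e x)"
    by (simp add: inner_vec_def sum_distrib_right scaleR_sum_left)
  also have "\<dots> = (\<Sum>x\<in>V. \<Sum>y\<in>V. (real l2 * (e y \<bullet> w)) *\<^sub>R e x
      + (if x = y then ((real r2 - real l2) * (e y \<bullet> w)) *\<^sub>R e x else 0))"
    by (intro sum.cong refl) (simp add: inn algebra_simps)
  also have "\<dots> = (\<Sum>x\<in>V. (real l2 * ((\<Sum>y\<in>V. e y) \<bullet> w)) *\<^sub>R e x)
      + (\<Sum>x\<in>V. ((real r2 - real l2) * (e x \<bullet> w)) *\<^sub>R e x)"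
    using fin by (simp add: sum.distrib inner_sum_left sum_distrib_left scaleR_sum_left)
  also have "(\<Sum>x\<in>V. (real l2 * ((\<Sum>y\<in>V. e y) \<bullet> w)) *\<^sub>R e x)
      = (real l2 * (real k1)\<^sup>2 * (1 \<bullet> w)) *\<^sub>R 1"
    by (simp add: se power2_eq_square flip: scaleR_sum_right)
  finally show ?thesis
    by (simp add: e_def scaleR_sum_right)
qed

text \<open>Pairing a vanishing combination with the all-ones vector shows that its coefficients sum
  to 0; pairing it with \<open>?e x\<close> then leaves (r - l) times the coefficient of
  \<open>x\<close>. Injectivity also comes from l < r, since equal vectors at distinct points would
  give l = r.\<close>

lemma independent_incidence_vec:
  assumes D: "block_design V B v b r k l"
  shows "independent (incidence_vec B ` V)" "inj_on (incidence_vec B) V"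
proof -
  let ?e = "incidence_vec B"
  have fin: "finite V" using D by (auto simp: block_design_def)
  have lr: "real l < real r" using design_index_less_replication[OF D] by simp
  show inj: "inj_on ?e V"
  proof (rule inj_onI)
    fix x y assume "x \<in> V" "y \<in> V" "?e x = ?e y"
    then show "x = y"
      using incidence_vec_inner[OF D, of x y] incidence_vec_inner[OF D, of x x] lr
      by (cases "x = y") auto
  qed
  show "independent (?e ` V)"
  proof (rule independent_if_scalars_zero)
    show "finite (?e ` V)" using fin by simp
    fix c u assume 0: "(\<Sum>u\<in>?e ` V. c u *\<^sub>R u) = 0" and "u \<in> ?e ` V"
    then obtain x where x: "x \<in> V" "u = ?e x" by auto
    have 1: "(\<Sum>y\<in>V. c (?e y) *\<^sub>R ?e y) = 0" using 0 inj by (simp add: sum.reindex)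
    define s where "s = (\<Sum>y\<in>V. c (?e y))"
    have "r * s = (\<Sum>y\<in>V. c (?e y) *\<^sub>R ?e y) \<bullet> 1"
      by (simp add: inner_sum_left incidence_vec_inner_one[OF D] s_def sum_distrib_left mult.commute)
    then have "s = 0" using 1 lr by auto
    have "0 = (\<Sum>y\<in>V. c (?e y) *\<^sub>R ?e y) \<bullet> ?e x" using 1 by simp
    also have "\<dots> = (\<Sum>y\<in>V. real l * c (?e y) + (if y = x then (real r - real l) * c (?e y) else 0))"
      unfolding inner_sum_left
      by (intro sum.cong refl) (use x in \<open>simp add: incidence_vec_inner[OF D] algebra_simps\<close>)
    also have "\<dots> = real l * s + (real r - real l) * c (?e x)"
      using fin x by (simp add: sum.distrib s_def sum_distrib_left)
    finally show "c u = 0" using x lr \<open>s = 0\<close> by simp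
  qed
qed

text \<open>Every incidence vector has the same inner product r with the all-ones vector, so
  differences are orthogonal to it.\<close>

lemma orthogonal_one_V_space:
  assumes "block_design V B v b r k l" "z \<in> V_space V B"
  shows "orthogonal 1 z"
  using assms(2) unfolding V_space_def
proof (rule orthogonal_to_span)
  fix z assume "z \<in> {Z_vec B x y | x y. x \<in> V \<and> y \<in> V}"
  then show "orthogonal 1 z"
    using incidence_vec_inner_one[OF assms(1)]
    by (auto simp: orthogonal_def Z_vec_eq inner_diff_left inner_commute[of 1])
qed

text \<open>The sum of all \<open>?e x\<close> is k times the all-ones vector, and the sum of
  \<open>?e x - ?e y\<close> over y is v \<open>?e x\<close> minus that vector. Dividing by k and by
  v gives the two inclusions.\<close>

lemma span_insert_one_V_space:
  assumes D: "block_design V B v b r k l"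
  shows "span (insert 1 (V_space V B)) = span (incidence_vec B ` V)"
proof (rule antisym; rule span_minimal)
  let ?e = "incidence_vec B" and ?U = "insert 1 (V_space V B)"
  have k: "real k \<noteq> 0" and v: "real v \<noteq> 0" "card V = v" using D by (auto simp: block_design_def)
  have "1 = (1 / real k) *\<^sub>R (\<Sum>x\<in>V. ?e x)" using k by (simp add: sum_incidence_vec[OF D])
  also have "\<dots> \<in> span (?e ` V)" by (intro span_scale span_sum span_base) auto
  finally have "1 \<in> span (?e ` V)" .
  moreover have "V_space V B \<subseteq> span (?e ` V)"
    unfolding V_space_def by (rule span_minimal) (auto simp: Z_vec_eq intro: span_diff span_base)
  ultimately show "?U \<subseteq> span (?e ` V)" by simp
  show "?e ` V \<subseteq> span ?U"
  proof clarify
    fix x assume x: "x \<in> V"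
    have "real v *\<^sub>R ?e x = (\<Sum>y\<in>V. Z_vec B x y) + real k *\<^sub>R 1"
      using v by (simp add: Z_vec_eq sum_subtractf sum_incidence_vec[OF D] sum_constant_scaleR
          del: sum_constant)
    then have "?e x = (1 / real v) *\<^sub>R ((\<Sum>y\<in>V. Z_vec B x y) + real k *\<^sub>R 1)"
      using v by (metis divideR_right divide_inverse_commute mult.right_neutral)
    moreover have "Z_vec B x y \<in> ?U" if "y \<in> V" for y
      using x that by (auto simp: V_space_def intro!: span_base)
    ultimately show "?e x \<in> span ?U"
      by (auto intro!: span_scale span_add span_sum intro: span_base)
  qed
qed auto

text \<open>Equality of the eigenspaces must exclude two singleton designs: there M is a permutation
  matrix, so A = I, both eigenvalues are 1, and each eigenspace is the whole space, of dimension v >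
  1.\<close>

theorem theorem2:
  fixes V :: "'a set"
    and B1 :: "'b1::finite \<Rightarrow> 'a set" and B2 :: "'b2::finite \<Rightarrow> 'a set"
    and v b1 r1 k1 l1 b2 r2 k2 l2 :: nat
    and M :: "real ^ 'b2 ^ 'b1" and A :: "real ^ 'b1 ^ 'b1" and \<mu>1 \<mu>2 :: real
  assumes "block_design V B1 v b1 r1 k1 l1"
    and "block_design V B2 v b2 r2 k2 l2"
    and "M = intersection_matrix B1 B2"
    and "A = M ** transpose M"
    and "\<mu>1 = real r1 * real r2 * real k1 * real k2"
    and "\<mu>2 = (real r1 - real l1) * (real r2 - real l2)"
  shows "rank A = v \<and>
    eigenvalue A \<mu>1 \<and> span {1} \<subseteq> eigenspace A \<mu>1 \<and>
    eigenvalue A \<mu>2 \<and> V_space V B1 \<subseteq> eigenspace A \<mu>2 \<and>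
    (\<not> (singleton_design V B1 \<and> singleton_design V B2) \<longrightarrow>
       eigenspace A \<mu>1 = span {1} \<and> eigenspace A \<mu>2 = V_space V B1) \<and>
    dim (V_space V B1) = v - 1 \<and>
    v \<le> b1 \<and>
    charpoly A = (-1) ^ b1 * [:0, 1:] ^ (b1 - v) * [:- \<mu>1, 1:] * [:- \<mu>2, 1:] ^ (v - 1)"
proof -
  note D1 = assms(1) and D2 = assms(2)
  define e where "e = incidence_vec B1"
  have fin: "finite V" and cardV: "card V = v" and b1: "CARD('b1) = b1"
    and k: "0 < k1" "k1 < v" "0 < k2" "k2 < v"
    using D1 D2 by (auto simp: block_design_def)
  have lr: "l1 < r1" "l2 < r2"
    using design_index_less_replication D1 D2 by blast+
  have \<mu>0: "\<mu>1 \<noteq> 0" "\<mu>2 \<noteq> 0"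
    using lr k assms by auto
  have Aw: "A *v w = (real r2 - real l2) *\<^sub>R (\<Sum>x\<in>V. (e x \<bullet> w) *\<^sub>R e x)
      + (real l2 * (real k1)\<^sup>2 * (1 \<bullet> w)) *\<^sub>R 1" for w
    unfolding assms(3,4) e_def by (rule intersection_matrix_mult_transpose[OF D1 D2])
  have sub_eig: "subspace (eigenspace A \<mu>)" for \<mu>
    by (auto simp: subspace_def eigenspace_def algebra_simps matrix_vector_mult_scaleR)
  have one0: "(1 :: real ^ 'b1) \<noteq> 0" by (simp add: vec_eq_iff)

  \<comment> \<open>Action on the all-ones vector and on \<open>V_space\<close>\<close>
  have A1: "A *v 1 = \<mu>1 *\<^sub>R 1"
  proof -
    have "real (r2 * (k2 - 1)) = real (l2 * (v - 1))"
      using design_replication_identity(1)[OF D2] by simp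
    then have id2: "real r2 * (real k2 - 1) = real l2 * (real v - 1)"
      using k by (simp add: of_nat_diff)
    have id1: "real b1 * real k1 = real v * real r1"
      using design_replication_identity(2)[OF D1] by (metis of_nat_mult)
    have "(\<Sum>x\<in>V. (e x \<bullet> 1) *\<^sub>R e x) = (\<Sum>x\<in>V. real r1 *\<^sub>R e x)"
      by (intro sum.cong refl) (simp add: e_def incidence_vec_inner_one[OF D1])
    also have "\<dots> = (real r1 * real k1) *\<^sub>R 1"
      by (simp add: e_def sum_incidence_vec[OF D1] flip: scaleR_sum_right)
    \<comment> \<open>Here 1 . 1 = b1. Substituting b1 k1 = v r1, and then l2 (v - 1) = r2 (k2 - 1),
      reduces the coefficient to \<open>\<mu>1\<close>.\<close>
    finally have "A *v 1 = ((real r2 - real l2) * (real r1 * real k1)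
        + real l2 * (real k1)\<^sup>2 * real b1) *\<^sub>R 1"
      by (simp add: Aw inner_vec_def b1 scaleR_add_left)
    also have "real l2 * (real k1)\<^sup>2 * real b1 = real l2 * real k1 * (real b1 * real k1)"
      by (simp add: power2_eq_square)
    also have "(real r2 - real l2) * (real r1 * real k1) + real l2 * real k1 * (real b1 * real k1)
        = real r1 * real k1 * (real r2 + real l2 * (real v - 1))"
      unfolding id1 by (simp add: algebra_simps)
    also have "\<dots> = \<mu>1"
      unfolding id2[symmetric] assms(5) by (simp add: algebra_simps)
    finally show ?thesis .
  qed
  have AZ: "V_space V B1 \<subseteq> eigenspace A \<mu>2"
    unfolding V_space_def
  proof (rule span_minimal[OF _ sub_eig], clarify)
    fix x y assume x: "x \<in> V" and y: "y \<in> V"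
    have Z: "Z_vec B1 x y = e x - e y" by (simp add: Z_vec_eq e_def)
    \<comment> \<open>The constant l1 of the Gram matrix cancels in the difference, leaving only the
      points \<open>x\<close> and \<open>y\<close>.\<close>
    have "(\<Sum>w\<in>V. (e w \<bullet> (e x - e y)) *\<^sub>R e w) =
        (\<Sum>w\<in>V. (if w = x then (real r1 - real l1) *\<^sub>R e w else 0)
          - (if w = y then (real r1 - real l1) *\<^sub>R e w else 0))"
      using x y by (intro sum.cong refl)
        (auto simp: e_def inner_diff_right incidence_vec_inner[OF D1] algebra_simps)
    also have "\<dots> = (real r1 - real l1) *\<^sub>R (e x - e y)"
      using fin x y by (simp add: sum_subtractf scaleR_diff_right)
    finally have "A *v (e x - e y) = \<mu>2 *\<^sub>R (e x - e y)"
      using x y incidence_vec_inner_one[OF D1]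
      by (simp add: Aw assms(6) inner_diff_right inner_commute[of 1] e_def mult.commute)
    then show "Z_vec B1 x y \<in> eigenspace A \<mu>2"
      by (simp add: Z eigenspace_def)
  qed

  \<comment> \<open>Orthogonal basis and dimension\<close>
  have subV: "subspace (V_space V B1)" by (simp add: V_space_def)
  then obtain C where C: "0 \<notin> C" "C \<subseteq> V_space V B1" "pairwise orthogonal C" "independent C"
      "card C = dim (V_space V B1)" "span C = V_space V B1"
    by (rule orthogonal_basis_subspace)
  have finC: "finite C" using C(4) independent_imp_finite by blast
  have orth1: "orthogonal 1 z" if "z \<in> V_space V B1" for z
    using orthogonal_one_V_space[OF D1] that by blast
  have "1 \<notin> C" using orth1[of 1] C(2) one0 by (auto simp: orthogonal_self)
  have orthS: "pairwise orthogonal (insert 1 C)"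
    using C(2,3) orth1 by (auto simp: pairwise_insert orthogonal_commute)
  have spanS: "span (insert 1 C) = span (e ` V)"
  proof -
    have "V_space V B1 \<subseteq> span (insert 1 C)" unfolding C(6)[symmetric] by (rule span_mono) auto
    then have "span (insert 1 C) = span (insert 1 (V_space V B1))"
      using C(2) by (auto simp: span_eq intro: span_base)
    then show ?thesis using span_insert_one_V_space[OF D1] by (simp add: e_def)
  qed
  have indS: "independent (insert 1 C)"
    using pairwise_orthogonal_independent[OF orthS] C(1) one0 by auto
  have dimE: "dim (e ` V) = v"
    using independent_incidence_vec[OF D1] cardV
    by (simp add: dim_eq_card_independent card_image e_def)
  \<comment> \<open>Both this orthogonal basis and the v independent incidence vectors span the same
    space.\<close>
  have cardS: "card (insert 1 C) = v"
    using indS spanS dimE by (metis dim_eq_card_independent dim_span)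
  then have cardC: "card C = v - 1" using \<open>1 \<notin> C\<close> finC by simp
  have "C \<noteq> {}" using cardC k by auto

  \<comment> \<open>Range and rank\<close>
  have range: "range ((*v) A) = span (e ` V)"
  proof
    have "1 \<in> span (e ` V)" unfolding spanS[symmetric] by (simp add: span_base)
    then show "range ((*v) A) \<subseteq> span (e ` V)"
      by (auto simp: Aw intro!: span_add span_scale span_sum intro: span_base)
    \<comment> \<open>An eigenvector for a nonzero eigenvalue m is the image of its multiple by 1 /
      m.\<close>
    have "s \<in> range ((*v) A)" if "A *v s = m *\<^sub>R s" "m \<noteq> 0" for s m
      using that by (intro image_eqI[of _ _ "(1 / m) *\<^sub>R s"])
        (auto simp: matrix_vector_mult_scaleR)
    moreover have "A *v s = \<mu>2 *\<^sub>R s" if "s \<in> C" for s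
      using AZ C(2) that by (auto simp: eigenspace_def)
    ultimately have "insert 1 C \<subseteq> range ((*v) A)"
      using A1 \<mu>0 by blast
    moreover have "subspace (range ((*v) A))"
      by (simp add: linear_subspace_image)
    ultimately show "span (e ` V) \<subseteq> range ((*v) A)"
      unfolding spanS[symmetric] by (rule span_minimal)
  qed
  have rank: "rank A = v" using range dimE by (simp add: rank_dim_range)
  have vb: "v \<le> b1"
    using dim_subset_UNIV[of "e ` V"] dimE b1 by simp

  have eig1: "span {1} \<subseteq> eigenspace A \<mu>1"
    using A1 by (intro span_minimal sub_eig) (simp add: eigenspace_def)
  have ev1: "eigenvalue A \<mu>1" using A1 one0 unfolding eigenvalue_def by blast
  have ev2: "eigenvalue A \<mu>2"
  proof -
    obtain z where "z \<in> C" using \<open>C \<noteq> {}\<close> by blast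
    then have "z \<noteq> 0" "z \<in> eigenspace A \<mu>2" using C(1,2) AZ by auto
    then show ?thesis unfolding eigenvalue_def eigenspace_def by blast
  qed

  \<comment> \<open>Exact eigenspaces\<close>
  have decomp: "\<exists>c z. w = c *\<^sub>R 1 + z \<and> z \<in> V_space V B1" if w: "w \<in> span (e ` V)" for w
  proof -
    obtain c where "w - c *\<^sub>R 1 \<in> V_space V B1"
      using w C(6) unfolding spanS[symmetric] span_breakdown_eq by auto
    then show ?thesis by (intro exI[of _ c] exI[of _ "w - c *\<^sub>R 1"]) simp
  qed
  have eigs: "eigenspace A \<mu>1 = span {1} \<and> eigenspace A \<mu>2 = V_space V B1" if "\<mu>1 \<noteq> \<mu>2"
  proof -
    \<comment> \<open>Applying A - m to \<open>c *\<^sub>R 1 + z\<close> keeps its two components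
      orthogonal, so each must vanish separately.\<close>
    have *: "(\<mu>1 - m) * c = 0 \<and> (\<mu>2 - m) *\<^sub>R z = 0"
      if z: "z \<in> V_space V B1" and w: "A *v (c *\<^sub>R 1 + z) = m *\<^sub>R (c *\<^sub>R 1 + z)" for m c z
    proof -
      have "A *v z = \<mu>2 *\<^sub>R z" using AZ z by (auto simp: eigenspace_def)
      then have eq: "((\<mu>1 - m) * c) *\<^sub>R 1 + (\<mu>2 - m) *\<^sub>R z = 0"
        using w A1 by (simp add: algebra_simps matrix_vector_mult_scaleR)
      then have "1 \<bullet> (((\<mu>1 - m) * c) *\<^sub>R 1 + (\<mu>2 - m) *\<^sub>R z) = 0" by simp
      then have "((\<mu>1 - m) * c) * (1 \<bullet> (1 :: real ^ 'b1)) = 0"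
        using orth1[OF z] by (simp add: inner_add_right orthogonal_def del: mult_eq_0_iff)
      then show ?thesis using eq one0 by auto
    qed
    have in_range: "w \<in> span (e ` V)" if "A *v w = m *\<^sub>R w" "m \<noteq> 0" for w m
    proof -
      have "w = A *v ((1 / m) *\<^sub>R w)" using that by (simp add: matrix_vector_mult_scaleR)
      then show ?thesis using range by blast
    qed
    have "w \<in> span {1}" if w: "A *v w = \<mu>1 *\<^sub>R w" for w
    proof -
      obtain c z where cz: "w = c *\<^sub>R 1 + z" "z \<in> V_space V B1"
        using decomp[OF in_range[OF w \<mu>0(1)]] by auto
      then have "z = 0" using *[of z c \<mu>1] w \<open>\<mu>1 \<noteq> \<mu>2\<close> by auto
      then show ?thesis using cz by (simp add: span_base span_scale)
    qed
    moreover have "w \<in> V_space V B1" if w: "A *v w = \<mu>2 *\<^sub>R w" for w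
    proof -
      obtain c z where cz: "w = c *\<^sub>R 1 + z" "z \<in> V_space V B1"
        using decomp[OF in_range[OF w \<mu>0(2)]] by auto
      then have "c = 0" using *[of z c \<mu>2] w \<open>\<mu>1 \<noteq> \<mu>2\<close> by auto
      then show ?thesis using cz by simp
    qed
    ultimately show ?thesis using eig1 AZ by (auto simp: eigenspace_def)
  qed
  have "\<mu>1 \<noteq> \<mu>2" if "\<not> (singleton_design V B1 \<and> singleton_design V B2)"
  proof -
    \<comment> \<open>A zero index forces a singleton design. One positive index gives
      \<open>\<mu>2\<close> < r1 r2, while r1 r2 is at most \<open>\<mu>1\<close>.\<close>
    have "0 < l1 \<or> 0 < l2" using that D1 D2 by (auto simp: block_design_def)
    then have "(r1 - l1) * (r2 - l2) < r1 * r2"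
    proof
      assume "0 < l1"
      then have "(r1 - l1) * (r2 - l2) \<le> (r1 - l1) * r2" "(r1 - l1) * r2 < r1 * r2" using lr by auto
      then show ?thesis by linarith
    next
      assume "0 < l2"
      then have "(r1 - l1) * (r2 - l2) \<le> r1 * (r2 - l2)" "r1 * (r2 - l2) < r1 * r2" using lr by auto
      then show ?thesis by linarith
    qed
    also have "r1 * r2 * 1 \<le> r1 * r2 * (k1 * k2)" using k by (intro mult_left_mono) auto
    finally have "real ((r1 - l1) * (r2 - l2)) < real (r1 * r2 * (k1 * k2))"
      by (simp only: of_nat_less_iff mult_1_right)
    then show ?thesis using lr by (simp add: assms(5,6) of_nat_diff mult_ac)
  qed
  note eigs = eigs[OF this]

  \<comment> \<open>Completion to an eigenbasis and the characteristic polynomial\<close>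
  obtain U where U: "U \<inter> insert 0 (insert 1 C) = {}" "pairwise orthogonal (insert 1 C \<union> U)"
      "span (insert 1 C \<union> U) = span (insert 1 C \<union> UNIV)"
    using orthogonal_extension_strong[OF orthS] by blast
  let ?T = "insert 1 C \<union> U"
  \<comment> \<open>As 0 is not in \<open>?T\<close>, orthogonality gives independence; since
    \<open>?T\<close> also spans, its cardinality is the full dimension.\<close>
  have indT: "independent ?T"
    using U(1,2) C(1) one0 by (intro pairwise_orthogonal_independent) auto
  then have finT: "finite ?T" by (rule independent_imp_finite)
  have "card ?T = dim (span ?T)"
    unfolding dim_span using dim_eq_card_independent[OF indT] by (rule sym)
  also have "\<dots> = dim (UNIV :: (real ^ 'b1) set)"
    unfolding U(3) dim_span by (simp only: Un_UNIV_right)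
  finally have cardT: "card ?T = CARD('b1)" by simp
  have disj: "insert 1 C \<inter> U = {}" using U(1) by blast
  have finU: "finite U" using finT by simp
  have "card ?T = card (insert 1 C) + card U"
    using finC finU disj by (intro card_Un_disjoint) simp_all
  then have cardU: "card U = b1 - v" unfolding cardS cardT b1 by simp
  \<comment> \<open>\<open>u\<close> is orthogonal to the all-ones vector and to all
    \<open>e x\<close>, so both terms of \<open>Aw\<close> vanish.\<close>
  have AU: "A *v u = 0" if "u \<in> U" for u
  proof -
    have "orthogonal u s" if s: "s \<in> insert 1 C" for s
    proof (rule pairwiseD[OF U(2)])
      show "u \<noteq> s" using disj s \<open>u \<in> U\<close> by blast
    qed (use s \<open>u \<in> U\<close> in \<open>blast+\<close>)
    then have orth: "orthogonal u s" if "s \<in> span (insert 1 C)" for s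
      using that by (intro orthogonal_to_span[of s "insert 1 C"])
    have "e x \<bullet> u = 0" if "x \<in> V" for x
      using orth[of "e x"] that unfolding spanS
      by (simp add: span_base orthogonal_def inner_commute)
    moreover have "1 \<bullet> u = 0"
      using orth[of 1] by (simp add: span_base orthogonal_def inner_commute)
    ultimately show ?thesis by (simp add: Aw)
  qed
  \<comment> \<open>Eigenvalues are attached to basis vectors, so multiplicities stay correct even
    when \<open>\<mu>1\<close> and \<open>\<mu>2\<close> coincide.\<close>
  define d where "d s = (if s = 1 then \<mu>1 else if s \<in> C then \<mu>2 else 0)" for s
  have "A *v s = d s *\<^sub>R s" if s: "s \<in> ?T" for s
  proof -
    consider "s = 1" | "s \<in> C" "s \<noteq> 1" | "s \<in> U" "s \<noteq> 1" "s \<notin> C" using s disj by blast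
    then show ?thesis
    proof cases
      case 1
      then show ?thesis using A1 by (simp add: d_def)
    next
      case 2
      then have "s \<in> eigenspace A \<mu>2" using C(2) AZ by blast
      then show ?thesis using 2 by (simp add: d_def eigenspace_def)
    next
      case 3
      then show ?thesis using AU by (simp add: d_def)
    qed
  qed
  from charpoly_eigenbasis[OF indT cardT this]
  have "charpoly A = (\<Prod>s\<in>?T. [:d s, -1:])" .
  also have "\<dots> = (\<Prod>s\<in>insert 1 C. [:d s, -1:]) * (\<Prod>s\<in>U. [:d s, -1:])"
    using finC finU disj by (intro prod.union_disjoint) simp_all
  also have "(\<Prod>s\<in>insert 1 C. [:d s, -1:]) = [:\<mu>1, -1:] * (\<Prod>s\<in>C. [:d s, -1:])"
    unfolding prod.insert[OF finC \<open>1 \<notin> C\<close>] d_def[of 1] if_P[OF refl] by (rule refl)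
  also have "(\<Prod>s\<in>C. [:d s, -1:]) = (\<Prod>s\<in>C. [:\<mu>2, -1:])"
  proof (intro prod.cong refl)
    fix s assume "s \<in> C"
    then have "s \<noteq> 1" using \<open>1 \<notin> C\<close> by blast
    then show "[:d s, -1:] = [:\<mu>2, -1:]" using \<open>s \<in> C\<close> by (simp add: d_def)
  qed
  also have "(\<Prod>s\<in>U. [:d s, -1:]) = (\<Prod>s\<in>U. [:0, -1:])"
  proof (intro prod.cong refl)
    fix s assume "s \<in> U"
    then have "s \<noteq> 1" "s \<notin> C" using disj by blast+
    then show "[:d s, -1:] = [:0, -1:]" by (simp add: d_def)
  qed
  finally have "charpoly A = [:\<mu>1, -1:] * [:\<mu>2, -1:] ^ (v - 1) * [:0, -1:] ^ (b1 - v)"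
    by (simp only: prod_constant cardC cardU)
  also have "\<dots> = (- [:-\<mu>1, 1:]) * (- [:-\<mu>2, 1:]) ^ (v - 1) * (- [:0, 1:]) ^ (b1 - v)"
    by (simp only: minus_pCons minus_minus minus_zero)
  also have "\<dots> = (-1) ^ Suc (v - 1 + (b1 - v))
      * [:0, 1:] ^ (b1 - v) * [:- \<mu>1, 1:] * [:- \<mu>2, 1:] ^ (v - 1)"
    by (rule neg_mult_power_neg)
  \<comment> \<open>The truncated subtractions are exact because 1 <= v <= b1.\<close>
  also have "Suc (v - 1 + (b1 - v)) = b1" using vb k by simp
  finally have cp: "charpoly A
      = (-1) ^ b1 * [:0, 1:] ^ (b1 - v) * [:- \<mu>1, 1:] * [:- \<mu>2, 1:] ^ (v - 1)" .
  have dim: "dim (V_space V B1) = v - 1" using C(5) cardC by simp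
  show ?thesis
    by (intro conjI impI rank ev1 eig1 ev2 AZ dim vb cp; use eigs in blast)
qed

end
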